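(* Let $M=(\mathcal{L},r)$ be a matroid or a $q$-matroid, let $\mathcal{P}$ be a Tutte partition of $M$, and let $\tau_{\mathcal{P}}(M;x,y)$ be the Tutte polynomial of $M$ with respect to $\mathcal{P}$. Then the rank generating polynomial of $M$ is $$\rho(M;x,y)=\alpha_q*\tau_{\mathcal{P}}(M;x,y).$$
   Context: A matroid or $q$-matroid is a pair $M=(\mathcal{L},r)$, where $\mathcal{L}$ is either the Boolean lattice of all subsets of a finite set (matroid case) or the lattice of all subspaces of a finite-dimensional vector space over $\mathbb{F}_q$, $q$ a prime power ($q$-matroid case), ordered by inclusion with meet $\wedge$ and join $\vee$. In the matroid case, formulas involving $q$ are read with $q=1$. $\mathrm{h}(x)$ is the cardinality, respectively dimension, of $x$; $\mathbf{0},\mathbf{1}$ are the least and greatest elements of $\mathcal{L}$. The function $r:\mathcal{L}\to\mathbb{Z}_{\ge 0}$ satisfies: $0\le r(x)\le \mathrm{h}(x)$; $x\le y\Rightarrow r(x)\le r(y)$; $r(x\vee y)+r(x\wedge y)\le r(x)+r(y)$. The nullity is $\nu(x)=\mathrm{h}(x)-r(x)$. A diamond is an interval $[a,b]$ with $\mathrm{h}(b)-\mathrm{h}(a)=2$; it is prime if $r(x)-r(a)=1$ and $r(b)-r(x)=0$ for every $a<x<b$. An interval is prime-free if it contains no prime diamond as a subinterval. A Tutte partition of $M$ is a partition $\mathcal{P}$ of the set $\mathcal{L}$ into intervals such that for every $[a,b]\in\mathcal{P}$: $r(a)=\mathrm{h}(a)$, $r(b)=r(\mathbf{1})$, and $[a,b]$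 is prime-free. The Tutte polynomial of $M$ with respect to a Tutte partition $\mathcal{P}$ is $$\tau_{\mathcal{P}}(M;x,y)=\sum_{[a,b]\in\mathcal{P}}x^{r(b)-r(a)}y^{\nu(b)-\nu(a)}.$$ The rank generating polynomial is $\rho(M;x,y)=\sum_{z\in\mathcal{L}}x^{r(\mathbf{1})-r(z)}y^{\nu(z)}\in\mathbb{Z}[x,y]$. Let $\alpha_q(n,m;i,j):=\left[\begin{smallmatrix} n \\ i \end{smallmatrix}\right]_q\left[\begin{smallmatrix} m \\ j \end{smallmatrix}\right]_q q^{(n-i)(m-j)}$ ($q$-binomial coefficients), and for $P=\sum_{i,j}p_{i,j}x^iy^j\in\mathbb{Z}[x,y]$ set $\alpha_q*P:=\sum_{i,j}p_{i,j}\sum_{a=0}^{i}\sum_{b=0}^{j}\alpha_q(i,j;a,b)x^ay^b$. *)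

theory Defs
  imports
    "HOL-Library.Disjoint_Sets"
    "HOL-Library.Cardinality"
    "HOL-Computational_Algebra.Polynomial"
begin

section \<open>Matroids and q-matroids\<close>

text \<open>
  Both kinds of lattices are families \<open>L\<close> of sets, ordered by inclusion: \<open>Pow E\<close> with height \<open>card\<close>, and all linear
  subspaces with height the dimension. The height \<open>h\<close> and the rank function \<open>r\<close> are total
  functions whose values outside \<open>L\<close> are irrelevant. The meet is \<open>\<inter>\<close>, the join is the least upper
  bound in \<open>L\<close>, and the greatest element is \<open>\<Union>L\<close>.
\<close>

definition lat_join :: "'a set set \<Rightarrow> 'a set \<Rightarrow> 'a set \<Rightarrow> 'a set" where
  "lat_join L x y = \<Inter>{z \<in> L. x \<subseteq> z \<and> y \<subseteq> z}"

definition rank_function ::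
    "'a set set \<Rightarrow> ('a set \<Rightarrow> nat) \<Rightarrow> ('a set \<Rightarrow> nat) \<Rightarrow> bool" where
  "rank_function L h r \<longleftrightarrow>
     (\<forall>x\<in>L. r x \<le> h x) \<and>
     (\<forall>x\<in>L. \<forall>y\<in>L. x \<subseteq> y \<longrightarrow> r x \<le> r y) \<and>
     (\<forall>x\<in>L. \<forall>y\<in>L. r (lat_join L x y) + r (x \<inter> y) \<le> r x + r y)"

definition matroid :: "'a set \<Rightarrow> ('a set \<Rightarrow> nat) \<Rightarrow> bool" where
  "matroid E r \<longleftrightarrow> finite E \<and> rank_function (Pow E) card r"

definition subspaces :: "('k::field \<Rightarrow> 'v::ab_group_add \<Rightarrow> 'v) \<Rightarrow> 'v set set" where
  "subspaces scale = {S. module.subspace scale S}"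

text \<open>
  The field \<open>\<bbbF>\<^sub>q\<close> is a type of class field and finite, so \<open>q = CARD('k)\<close>; the vector space is the
  whole type \<open>'v\<close>, and \<open>B\<close> is some finite basis witnessing finite dimension.
\<close>

definition q_matroid ::
    "('k::{field,finite} \<Rightarrow> 'v::ab_group_add \<Rightarrow> 'v) \<Rightarrow> 'v set \<Rightarrow> ('v set \<Rightarrow> nat) \<Rightarrow> bool" where
  "q_matroid scale B r \<longleftrightarrow>
     finite_dimensional_vector_space scale B \<and>
     rank_function (subspaces scale) (vector_space.dim scale) r"

text \<open>The lattice operations are the expected ones in the two cases.\<close>

lemma lat_join_Pow:
  assumes "x \<subseteq> E" "y \<subseteq> E"
  shows "lat_join (Pow E) x y = x \<union> y"
  using assms unfolding lat_join_def by blast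

lemma Union_Pow: "\<Union>(Pow E) = E"
  by simp

lemma lat_join_subspaces:
  assumes "vector_space scale"
  shows "lat_join (subspaces scale) x y = module.span scale (x \<union> y)"
proof -
  interpret vector_space scale by fact
  show ?thesis
    unfolding lat_join_def subspaces_def
  proof
    show "\<Inter> {z \<in> {S. subspace S}. x \<subseteq> z \<and> y \<subseteq> z} \<subseteq> span (x \<union> y)"
      using span_superset[of "x \<union> y"] by (intro Inter_lower) auto
    show "span (x \<union> y) \<subseteq> \<Inter> {z \<in> {S. subspace S}. x \<subseteq> z \<and> y \<subseteq> z}"
      by (intro Inter_greatest span_minimal) auto
  qed
qed

lemma Union_subspaces:
  assumes "vector_space scale"
  shows "\<Union>(subspaces scale) = UNIV"
proof -
  interpret vector_space scale by fact
  show ?thesis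
    unfolding subspaces_def using subspace_UNIV by blast
qed


section \<open>Tutte partitions\<close>

definition interval :: "'a set set \<Rightarrow> 'a set \<Rightarrow> 'a set \<Rightarrow> 'a set set" where
  "interval L a b = {x \<in> L. a \<subseteq> x \<and> x \<subseteq> b}"

text \<open>Differences of heights and ranks are stated additively, to avoid truncated subtraction.\<close>

definition diamond :: "'a set set \<Rightarrow> ('a set \<Rightarrow> nat) \<Rightarrow> 'a set \<Rightarrow> 'a set \<Rightarrow> bool" where
  "diamond L h a b \<longleftrightarrow> a \<in> L \<and> b \<in> L \<and> a \<subseteq> b \<and> h b = h a + 2"

definition prime_diamond ::
    "'a set set \<Rightarrow> ('a set \<Rightarrow> nat) \<Rightarrow> ('a set \<Rightarrow> nat) \<Rightarrow> 'a set \<Rightarrow> 'a set \<Rightarrow> bool" where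
  "prime_diamond L h r a b \<longleftrightarrow>
     diamond L h a b \<and> (\<forall>x\<in>L. a \<subset> x \<and> x \<subset> b \<longrightarrow> r x = r a + 1 \<and> r b = r x)"

definition prime_free ::
    "'a set set \<Rightarrow> ('a set \<Rightarrow> nat) \<Rightarrow> ('a set \<Rightarrow> nat) \<Rightarrow> 'a set \<Rightarrow> 'a set \<Rightarrow> bool" where
  "prime_free L h r a b \<longleftrightarrow> \<not> (\<exists>c d. a \<subseteq> c \<and> d \<subseteq> b \<and> prime_diamond L h r c d)"

text \<open>
  A partition into intervals is given by the set \<open>P\<close> of the pairs of endpoints of its blocks; a
  nonempty interval determines its endpoints.
\<close>

definition tutte_partition ::
    "'a set set \<Rightarrow> ('a set \<Rightarrow> nat) \<Rightarrow> ('a set \<Rightarrow> nat) \<Rightarrow> ('a set \<times> 'a set) set \<Rightarrow> bool" where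
  "tutte_partition L h r P \<longleftrightarrow>
     (\<forall>(a, b)\<in>P. a \<in> L \<and> b \<in> L \<and> a \<subseteq> b) \<and>
     partition_on L ((\<lambda>(a, b). interval L a b) ` P) \<and>
     (\<forall>(a, b)\<in>P. r a = h a \<and> r b = r (\<Union>L) \<and> prime_free L h r a b)"

lemma interval_eq_iff:
  assumes "a \<in> L" "b \<in> L" "a \<subseteq> b" "c \<in> L" "d \<in> L" "c \<subseteq> d"
  shows "interval L a b = interval L c d \<longleftrightarrow> a = c \<and> b = d"
proof
  assume eq: "interval L a b = interval L c d"
  have "a \<in> interval L c d" "b \<in> interval L c d"
    using assms unfolding eq[symmetric] by (auto simp: interval_def)
  moreover have "c \<in> interval L a b" "d \<in> interval L a b"
    using assms unfolding eq by (auto simp: interval_def)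
  ultimately show "a = c \<and> b = d"
    by (auto simp: interval_def)
qed simp


section \<open>Bivariate polynomials\<close>

text \<open>
  \<open>\<int>[x,y]\<close> is represented as \<open>\<int>[x][y]\<close>, the type \<open>int poly poly\<close>: the inner variable is \<open>x\<close> and the
  outer one is \<open>y\<close>. \<open>bimonom c i j\<close> is \<open>c x\<^sup>i y\<^sup>j\<close>, and \<open>bicoeff p i j\<close> is the coefficient of
  \<open>x\<^sup>i y\<^sup>j\<close>.
\<close>

definition bimonom :: "int \<Rightarrow> nat \<Rightarrow> nat \<Rightarrow> int poly poly" where
  "bimonom c i j = monom (monom c i) j"

definition bicoeff :: "int poly poly \<Rightarrow> nat \<Rightarrow> nat \<Rightarrow> int" where
  "bicoeff p i j = coeff (coeff p j) i"

lemma bicoeff_bimonom: "bicoeff (bimonom c i j) a b = (if a = i \<and> b = j then c else 0)"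
  by (auto simp: bicoeff_def bimonom_def)

lemma bimonom_eq: "bimonom c i j = of_int c * [:[:0, 1:]:] ^ i * [:0, 1:] ^ j"
  by (simp add: bimonom_def monom_altdef poly_const_pow of_int_poly)

text \<open>
  In the exponents below, truncated subtraction on naturals agrees with the subtraction of integers,
  since rank and nullity are monotone and the rank is bounded by the height.
\<close>

definition nullity :: "('a set \<Rightarrow> nat) \<Rightarrow> ('a set \<Rightarrow> nat) \<Rightarrow> 'a set \<Rightarrow> nat" where
  "nullity h r x = h x - r x"

definition tutte_poly ::
    "('a set \<Rightarrow> nat) \<Rightarrow> ('a set \<Rightarrow> nat) \<Rightarrow> ('a set \<times> 'a set) set \<Rightarrow> int poly poly" where
  "tutte_poly h r P = (\<Sum>(a, b)\<in>P. bimonom 1 (r b - r a) (nullity h r b - nullity h r a))"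

definition rank_gen_poly ::
    "'a set set \<Rightarrow> ('a set \<Rightarrow> nat) \<Rightarrow> ('a set \<Rightarrow> nat) \<Rightarrow> int poly poly" where
  "rank_gen_poly L h r = (\<Sum>z\<in>L. bimonom 1 (r (\<Union>L) - r z) (nullity h r z))"


section \<open>The transform by q-binomial coefficients\<close>

text \<open>
  The q-binomial coefficients are defined by the q-Pascal rule, which also covers \<open>q = 1\<close>.
  The lemmas below identify them with the quotients of q-factorials, and with the binomial
  coefficients for \<open>q = 1\<close>.
\<close>

fun qbinomial :: "nat \<Rightarrow> nat \<Rightarrow> nat \<Rightarrow> nat" where
  "qbinomial q n 0 = 1"
| "qbinomial q 0 (Suc k) = 0"
| "qbinomial q (Suc n) (Suc k) = qbinomial q n k + q ^ Suc k * qbinomial q n (Suc k)"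

definition qint :: "nat \<Rightarrow> nat \<Rightarrow> nat" where
  "qint q n = (\<Sum>i<n. q ^ i)"

definition qfact :: "nat \<Rightarrow> nat \<Rightarrow> nat" where
  "qfact q n = (\<Prod>i=1..n. qint q i)"

lemma qbinomial_eq_0: "n < k \<Longrightarrow> qbinomial q n k = 0"
  by (induction q n k rule: qbinomial.induct) auto

lemma qbinomial_1: "qbinomial 1 n k = n choose k"
  by (induction "1::nat" n k rule: qbinomial.induct) auto

lemma qint_add: "qint q (m + n) = qint q m + q ^ m * qint q n"
  by (induction n) (auto simp: qint_def power_add algebra_simps)

lemma qfact_Suc: "qfact q (Suc n) = qint q (Suc n) * qfact q n"
  by (simp add: qfact_def mult.commute)

lemma qbinomial_qfact: "k \<le> n \<Longrightarrow> qbinomial q n k * (qfact q k * qfact q (n - k)) = qfact q n"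
proof (induction q n k rule: qbinomial.induct)
  case (1 q n)
  then show ?case by (simp add: qfact_def)
next
  case (2 q k)
  then show ?case by simp
next
  case (3 q n k)
  show ?case
  proof (cases "k = n")
    case True
    then show ?thesis
      using 3(1) by (auto simp: qbinomial_eq_0 qfact_def)
  next
    case False
    then obtain m where n: "n = k + Suc m"
      using 3(3) less_imp_Suc_add[of k n] by auto
    have b: "qbinomial q n k * (qfact q k * qfact q (Suc m)) = qfact q n"
      and c: "qbinomial q n (Suc k) * (qfact q (Suc k) * qfact q m) = qfact q n"
      using 3 by (auto simp: n)
    have "qbinomial q (Suc n) (Suc k) * (qfact q (Suc k) * qfact q (Suc m)) =
        qint q (Suc k) * (qbinomial q n k * (qfact q k * qfact q (Suc m))) +
        q ^ Suc k * qint q (Suc m) * (qbinomial q n (Suc k) * (qfact q (Suc k) * qfact q m))"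
      by (simp add: qfact_Suc algebra_simps)
    also have "\<dots> = (qint q (Suc k) + q ^ Suc k * qint q (Suc m)) * qfact q n"
      unfolding b c by (simp only: algebra_simps)
    also have "\<dots> = qfact q (Suc n)"
      using qint_add[of q "Suc k" "Suc m"] by (simp add: n qfact_Suc)
    finally show ?thesis by (simp add: n)
  qed
qed

definition alpha :: "nat \<Rightarrow> nat \<Rightarrow> nat \<Rightarrow> nat \<Rightarrow> nat \<Rightarrow> nat" where
  "alpha q n m i j = qbinomial q n i * qbinomial q m j * q ^ ((n - i) * (m - j))"

text \<open>The two outer sums range over a finite set containing the support of \<open>p\<close>.\<close>

definition alpha_star :: "nat \<Rightarrow> int poly poly \<Rightarrow> int poly poly" where
  "alpha_star q p =
     (\<Sum>j\<le>degree p. \<Sum>i\<le>degree (coeff p j).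
        \<Sum>a\<le>i. \<Sum>b\<le>j. bimonom (bicoeff p i j * int (alpha q i j a b)) a b)"

end

theory Submission
  imports Defs
begin

text \<open>
  The blocks of a Tutte partition contribute independently. The transform is additive, and a block
  \<open>[a, b]\<close> contributes one monomial \<open>x\<^sup>i y\<^sup>j\<close> to the Tutte polynomial, so it is enough to show that
  the terms of the rank generating polynomial that belong to the elements of \<open>[a, b]\<close> add up to
  the transform of \<open>x\<^sup>i y\<^sup>j\<close> (\<open>rank_gen_poly_interval\<close>).

  The reason is that a prime-free interval has the simplest possible rank function
  (\<open>prime_free_rank\<close>): it contains an element \<open>c\<close>, the join of the loops over \<open>a\<close>, such that the
  rank of \<open>z\<close> over \<open>a\<close> is \<open>h z - h (z \<inter> c)\<close>. In other words, the block is a direct sum of \<open>j\<close> loops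
  and \<open>i\<close> coloops, where \<open>j = h c - h a\<close> and \<open>i = h b - h c\<close>. An obstruction to this would be a
  circuit in \<open>[c, b]\<close> of height at least two over \<open>c\<close>, and the top of such a circuit carries a
  prime diamond.

  Since \<open>a\<close> is independent and \<open>b\<close> spans, the corank of \<open>z\<close> is \<open>s\<close> and its nullity is \<open>t\<close> if and
  only if \<open>z \<inter> c\<close> has height \<open>t\<close> over \<open>a\<close> and \<open>z\<close> has height \<open>i - s\<close> over \<open>z \<inter> c\<close>. Such \<open>z\<close> are
  counted by choosing \<open>z \<inter> c\<close>, then the join of \<open>z\<close> and \<open>c\<close>, and then \<open>z\<close> as a complement of \<open>c\<close>
  between the two (\<open>card_of_relative_height\<close>). The three choices give the three factors of
  \<open>alpha q i j s t\<close>.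

  Subsets and subspaces are treated together: all the counting follows from the modularity of the
  height and from the number of atoms of an interval, \<open>qint q n\<close> for height \<open>n\<close>.
\<close>

section \<open>Counting in modular lattices of sets\<close>

lemma card_by_constant_fibres:
  assumes "finite A" "finite T" "f ` A \<subseteq> T" "\<And>y. y \<in> T \<Longrightarrow> card {x \<in> A. f x = y} = n"
  shows "card A = card T * n"
proof -
  have "card A = (\<Sum>y\<in>T. card {x \<in> A. f x = y})"
    using sum.group[OF assms(1-3), of "\<lambda>_. 1::nat"] by simp
  also have "\<dots> = card T * n"
    using assms(4) by simp
  finally show ?thesis .
qed

lemma qint_pos: "0 < n \<Longrightarrow> 0 < qint q n"
  using member_le_sum[of 0 "{..<n}" "\<lambda>i. q ^ i"] by (simp add: qint_def)

lemma power_eq_qint: "Suc p ^ n = 1 + p * qint (Suc p) n"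
  by (induction n) (simp_all add: qint_def distrib_left)

text \<open>
  The common features of Boolean lattices (\<open>q = 1\<close>) and of subspace lattices over a field with \<open>q\<close>
  elements. The two kinds differ only in the number of atoms of an interval.
\<close>

locale q_lattice =
  fixes L :: "'a set set" and h :: "'a set \<Rightarrow> nat" and q :: nat
  assumes finite_L: "finite L"
    and nonempty_L: "L \<noteq> {}"
    and meet_in: "\<lbrakk>x \<in> L; y \<in> L\<rbrakk> \<Longrightarrow> x \<inter> y \<in> L"
    and top_in: "\<Union>L \<in> L"
    and height_bot: "h (\<Inter>L) = 0"
    and height_strict: "\<lbrakk>x \<in> L; y \<in> L; x \<subset> y\<rbrakk> \<Longrightarrow> h x < h y"
    and height_modular: "\<lbrakk>x \<in> L; y \<in> L\<rbrakk> \<Longrightarrow> h (lat_join L x y) + h (x \<inter> y) = h x + h y"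
    and card_atoms:
      "\<lbrakk>a \<in> L; b \<in> L; a \<subseteq> b\<rbrakk> \<Longrightarrow> card {x \<in> interval L a b. h x = h a + 1} = qint q (h b - h a)"
    and q_pos: "0 < q"
begin

abbreviation join (infixl "\<squnion>" 65) where "x \<squnion> y \<equiv> lat_join L x y"

lemma join_upper: "x \<subseteq> x \<squnion> y" "y \<subseteq> x \<squnion> y"
  by (auto simp: lat_join_def)

lemma join_least: "\<lbrakk>z \<in> L; x \<subseteq> z; y \<subseteq> z\<rbrakk> \<Longrightarrow> x \<squnion> y \<subseteq> z"
  by (auto simp: lat_join_def)

lemma Inter_in:
  assumes "A \<subseteq> L" "A \<noteq> {}"
  shows "\<Inter>A \<in> L"
proof -
  have "finite A"
    using assms finite_L finite_subset by blast
  then show ?thesis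
    using assms(2,1) by (induction rule: finite_ne_induct) (auto intro: meet_in)
qed

lemma join_in:
  assumes "x \<in> L" "y \<in> L"
  shows "x \<squnion> y \<in> L"
  unfolding lat_join_def using assms top_in by (intro Inter_in) auto

lemma bot_in: "\<Inter>L \<in> L"
  using Inter_in nonempty_L by blast

lemma height_mono: "\<lbrakk>x \<in> L; y \<in> L; x \<subseteq> y\<rbrakk> \<Longrightarrow> h x \<le> h y"
  using height_strict[of x y] by (cases "x = y") (auto intro: less_imp_le)

lemma height_eqD: "\<lbrakk>x \<in> L; y \<in> L; x \<subseteq> y; h y \<le> h x\<rbrakk> \<Longrightarrow> x = y"
  using height_strict[of x y] by (cases "x = y") auto

lemma finite_interval: "finite (interval L a b)"
  using finite_L by (auto simp: interval_def)

lemma element_of_height: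
  assumes "a \<in> L" "b \<in> L" "a \<subseteq> b" "h a \<le> n" "n \<le> h b"
  obtains d where "d \<in> L" "a \<subseteq> d" "d \<subseteq> b" "h d = n"
proof -
  have "n \<le> h b \<Longrightarrow> \<exists>d\<in>L. a \<subseteq> d \<and> d \<subseteq> b \<and> h d = n"
    using \<open>h a \<le> n\<close>
  proof (induction n rule: dec_induct)
    case base
    then show ?case using assms by auto
  next
    case (step n)
    then obtain d where d: "d \<in> L" "a \<subseteq> d" "d \<subseteq> b" "h d = n" by auto
    have "0 < qint q (h b - h d)"
      using step.prems d(4) by (simp add: qint_pos)
    then obtain x where "x \<in> {x \<in> interval L d b. h x = h d + 1}"
      using card_atoms[OF d(1) assms(2) d(3)] by (metis card_gt_0_iff ex_in_conv)
    then show ?case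
      using d by (auto simp: interval_def intro!: bexI[of _ x])
  qed
  then show thesis using assms(5) that by blast
qed

definition complements :: "'a set \<Rightarrow> 'a set \<Rightarrow> 'a set \<Rightarrow> 'a set set" where
  "complements a c b = {z \<in> L. z \<inter> c = a \<and> z \<squnion> c = b}"

lemma complement_height:
  assumes "c \<in> L" "z \<in> complements a c b"
  shows "h z + h c = h a + h b"
  using height_modular[of z c] assms by (auto simp: complements_def)

lemma complementI:
  assumes "c \<in> L" "b \<in> L" "z \<in> L" "c \<subseteq> b" "z \<subseteq> b" "z \<inter> c = a" "h a + h b \<le> h z + h c"
  shows "z \<in> complements a c b"
proof -
  have "z \<squnion> c = b"
    using assms height_modular[of z c] by (intro height_eqD join_in join_least) auto
  then show ?thesis using assms by (simp add: complements_def)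
qed

text \<open>
  A complement of \<open>c\<close> in \<open>[a, b]\<close> is built one step at a time. If \<open>u\<close> is a coatom of \<open>[c, b]\<close>,
  then every complement \<open>z\<close> of \<open>c\<close> in \<open>[a, b]\<close> covers the complement \<open>z \<inter> u\<close> of \<open>c\<close> in
  \<open>[a, u]\<close>; conversely a complement \<open>w\<close> in \<open>[a, u]\<close> is extended by exactly those atoms of \<open>[w, b]\<close>
  that do not lie below \<open>u\<close>. With \<open>m = h c - h a\<close> these are \<open>qint q (m + 1) - qint q m\<close>, that is,
  \<open>q ^ m\<close> many.
\<close>

lemma card_complements:
  assumes "a \<in> L" "c \<in> L" "b \<in> L" "a \<subseteq> c" "c \<subseteq> b"
  shows "card (complements a c b) = q ^ ((h c - h a) * (h b - h c))"
  using assms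
proof (induction "h b - h c" arbitrary: b)
  case 0
  then have "b = c" using height_eqD[of c b] by simp
  have "complements a c c = {a}"
  proof
    show "complements a c c \<subseteq> {a}"
      using join_upper(1) by (fastforce simp: complements_def)
    show "{a} \<subseteq> complements a c c"
      using 0 by (auto intro!: complementI)
  qed
  then show ?case using \<open>b = c\<close> by simp
next
  case (Suc n)
  have "h c + n \<le> h b" using Suc.hyps(2) by linarith
  then obtain u where u: "u \<in> L" "c \<subseteq> u" "u \<subseteq> b" and hu: "h u = h c + n"
    using element_of_height[of c b "h c + n"] Suc.prems by auto
  have hub: "h b = Suc (h u)" using hu Suc.hyps(2) by linarith
  have hcu: "h c \<le> h u" and hac: "h a \<le> h c"
    using u Suc.prems height_mono by auto
  have IH: "card (complements a c u) = q ^ ((h c - h a) * (h u - h c))"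
    using Suc.hyps(1)[of u] Suc.prems u hu by simp
  have meet_u: "h (z \<inter> u) + 1 = h z" "z \<subseteq> b" "z \<in> L" "z \<inter> c = a" "z \<inter> u \<in> L"
    "h z + h c = h a + h b" if "z \<in> complements a c b" for z
  proof -
    have z: "z \<in> L" "z \<inter> c = a" "z \<squnion> c = b" using that by (auto simp: complements_def)
    have "z \<subseteq> b" using z(3) join_upper by auto
    moreover have "z \<squnion> u = b"
    proof
      show "z \<squnion> u \<subseteq> b" using Suc.prems(3) \<open>z \<subseteq> b\<close> u(3) by (rule join_least)
      have "z \<squnion> c \<subseteq> z \<squnion> u"
        using join_in[OF z(1) u(1)] join_upper u(2) by (intro join_least) blast+
      then show "b \<subseteq> z \<squnion> u" using z(3) by simp
    qed
    ultimately show "h (z \<inter> u) + 1 = h z" "z \<subseteq> b" "z \<in> L" "z \<inter> c = a" "z \<inter> u \<in> L"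
      "h z + h c = h a + h b"
      using height_modular[of z u] z u hub meet_in complement_height[OF Suc.prems(2) that] by auto
  qed
  have "card (complements a c b) = card (complements a c u) * q ^ (h c - h a)"
  proof (rule card_by_constant_fibres[where f = "\<lambda>z. z \<inter> u"])
    show "finite (complements a c b)" "finite (complements a c u)"
      using finite_L by (auto simp: complements_def)
    show "(\<lambda>z. z \<inter> u) ` complements a c b \<subseteq> complements a c u"
    proof
      fix w assume "w \<in> (\<lambda>z. z \<inter> u) ` complements a c b"
      then obtain z where z: "w = z \<inter> u" "z \<in> complements a c b" by auto
      then show "w \<in> complements a c u"
        using meet_u[OF z(2)] u hub Suc.prems by (intro complementI) auto
    qed
    fix w assume w: "w \<in> complements a c u"
    have w': "w \<in> L" "w \<inter> c = a" "w \<subseteq> u" "w \<subseteq> b" "h w + h c = h a + h u"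
      using w u join_upper(1)[of w c] complement_height[OF Suc.prems(2) w]
      by (auto simp: complements_def)
    let ?atoms = "\<lambda>v. {z \<in> interval L w v. h z = h w + 1}"
    have "{z \<in> complements a c b. z \<inter> u = w} = ?atoms b - ?atoms u"
    proof (intro subset_antisym subsetI)
      fix z assume z: "z \<in> {z \<in> complements a c b. z \<inter> u = w}"
      then show "z \<in> ?atoms b - ?atoms u"
        using meet_u[of z] by (auto simp: interval_def Int_absorb2)
    next
      fix z assume "z \<in> ?atoms b - ?atoms u"
      then have z: "z \<in> L" "w \<subseteq> z" "z \<subseteq> b" "h z = h w + 1" "\<not> z \<subseteq> u"
        by (auto simp: interval_def)
      have "h (z \<inter> u) < h z"
        using z u by (intro height_strict meet_in) auto
      then have zu: "w = z \<inter> u"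
        using z u w' by (intro height_eqD meet_in) auto
      then have "z \<inter> c = a" using w'(2) u by blast
      then show "z \<in> {z \<in> complements a c b. z \<inter> u = w}"
        using zu z w' hub Suc.prems by (auto intro!: complementI)
    qed
    moreover have "?atoms u \<subseteq> ?atoms b" using u by (auto simp: interval_def)
    ultimately have "card {z \<in> complements a c b. z \<inter> u = w} = card (?atoms b) - card (?atoms u)"
      using finite_interval by (simp add: card_Diff_subset)
    also have "\<dots> = qint q (h b - h w) - qint q (h u - h w)"
      using card_atoms[of w b] card_atoms[of w u] w' u Suc.prems by simp
    also have "h b - h w = Suc (h u - h w)"
      using w'(5) hub hac by linarith
    also have "h u - h w = h c - h a"
      using w'(5) hub hac hcu by linarith
    finally show "card {z \<in> complements a c b. z \<inter> u = w} = q ^ (h c - h a)"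
      by (simp add: qint_def)
  qed
  also have "\<dots> = q ^ ((h c - h a) * (h b - h c))"
    using IH hub hcu by (simp add: Suc_diff_le power_add)
  finally show ?case .
qed

text \<open>
  The recursion for the q-binomial coefficients is realised by fixing an atom \<open>e\<close> of the interval:
  the elements above \<open>e\<close> give the first summand, and every other \<open>z\<close> is a complement of \<open>e\<close>
  in \<open>[a, z \<squnion> e]\<close>, of which there are \<open>q ^ Suc k\<close> for a given join.
\<close>

lemma card_of_height:
  assumes "a \<in> L" "b \<in> L" "a \<subseteq> b"
  shows "card {z \<in> interval L a b. h z = h a + k} = qbinomial q (h b - h a) k"
  using assms
proof (induction "h b - h a" arbitrary: a k)
  case 0
  then have "b = a" using height_eqD[of a b] by simp
  then have eq: "{z \<in> interval L a b. h z = h a + k} = (if k = 0 then {a} else {})"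
    using 0 by (auto simp: interval_def)
  show ?case unfolding eq using \<open>b = a\<close> by (cases k) simp_all
next
  case (Suc n)
  show ?case
  proof (cases k)
    case 0
    have "{z \<in> interval L a b. h z = h a + k} = {a}"
      using 0 Suc.prems by (auto simp: interval_def dest: height_eqD[of a])
    then show ?thesis using 0 by simp
  next
    case (Suc l)
    note ab = Suc.prems
    obtain e where e: "e \<in> L" "a \<subseteq> e" "e \<subseteq> b" "h e = h a + 1"
    proof (rule element_of_height[OF ab, of "h a + 1"])
      show "h a + 1 \<le> h b" using Suc.hyps(2) by linarith
    qed auto
    have n: "n = h b - h e" using e(4) Suc.hyps(2) by simp
    let ?A = "{z \<in> interval L a b. h z = h a + k}"
    let ?above = "{z \<in> interval L e b. h z = h e + l}"
    let ?joins = "{u \<in> interval L e b. h u = h e + k}"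
    let ?rest = "{z \<in> ?A. \<not> e \<subseteq> z}"
    have "?A = ?above \<union> ?rest"
      using e Suc by (auto simp: interval_def)
    moreover have "card (?above \<union> ?rest) = card ?above + card ?rest"
      using finite_interval by (intro card_Un_disjoint) (simp, simp, auto simp: interval_def)
    ultimately have "card ?A = card ?above + card ?rest"
      by (rule trans[OF arg_cong])
    also have "card ?above = qbinomial q n l"
      using Suc.hyps(1)[OF n] e ab n by simp
    also have "card ?rest = card ?joins * q ^ k"
    proof (rule card_by_constant_fibres[where f = "\<lambda>z. z \<squnion> e"])
      show "finite ?rest" "finite ?joins" using finite_interval by auto
      have meet_e: "z \<inter> e = a" if "z \<in> ?rest" for z
      proof -
        have z: "z \<in> L" "a \<subseteq> z" "\<not> e \<subseteq> z" using that by (auto simp: interval_def)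
        then have "h (z \<inter> e) < h e" using e by (intro height_strict meet_in) auto
        then show ?thesis using z e ab by (intro height_eqD[symmetric] meet_in) auto
      qed
      show "(\<lambda>z. z \<squnion> e) ` ?rest \<subseteq> ?joins"
      proof
        fix u assume "u \<in> (\<lambda>z. z \<squnion> e) ` ?rest"
        then obtain z where z: "u = z \<squnion> e" "z \<in> ?rest" by blast
        then show "u \<in> ?joins"
          using meet_e[OF z(2)] height_modular[of z e] e ab join_in[of z e] join_upper[of e z]
            join_upper[of z e] join_least[of b z e]
          by (auto simp: interval_def)
      qed
      fix u assume u: "u \<in> ?joins"
      have "{z \<in> ?rest. z \<squnion> e = u} = complements a e u"
      proof (intro subset_antisym subsetI)
        fix z assume z: "z \<in> {z \<in> ?rest. z \<squnion> e = u}"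
        then have "z \<inter> e = a" using meet_e by blast
        then show "z \<in> complements a e u" using z by (auto simp: complements_def interval_def)
      next
        fix z assume z: "z \<in> complements a e u"
        have "h z + h e = h a + h u" by (rule complement_height[OF e(1) z])
        moreover have "\<not> e \<subseteq> z" using z e by (auto simp: complements_def Int_absorb1)
        moreover have "z \<subseteq> u" using z join_upper by (auto simp: complements_def)
        ultimately show "z \<in> {z \<in> ?rest. z \<squnion> e = u}"
          using z u e by (auto simp: complements_def interval_def)
      qed
      then show "card {z \<in> ?rest. z \<squnion> e = u} = q ^ k"
        using card_complements[of a e u] u e ab by (auto simp: interval_def)
    qed
    also have "card ?joins = qbinomial q n k"
      using Suc.hyps(1)[OF n] e ab n by simp
    finally show ?thesis
      using Suc.hyps(2)[symmetric] Suc by simp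
  qed
qed

text \<open>
  An element \<open>z\<close> of \<open>[a, b]\<close> is a complement of \<open>c\<close> in \<open>[z \<inter> c, z \<squnion> c]\<close>. So it is
  determined by an element of \<open>[a, c]\<close>, an element of \<open>[c, b]\<close>, and a choice of a complement. This
  is where the shape of the coefficients \<open>alpha q\<close> comes from.
\<close>

lemma card_of_relative_height:
  assumes "a \<in> L" "c \<in> L" "b \<in> L" "a \<subseteq> c" "c \<subseteq> b"
  shows "card {z \<in> interval L a b. h (z \<inter> c) = h a + t \<and> h z = h a + t + k} =
    qbinomial q (h c - h a) t * qbinomial q (h b - h c) k * q ^ ((h c - h a - t) * k)"
proof -
  let ?A = "{z \<in> interval L a b. h (z \<inter> c) = h a + t \<and> h z = h a + t + k}"
  let ?W = "{w \<in> interval L a c. h w = h a + t}"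
  let ?U = "{u \<in> interval L c b. h u = h c + k}"
  have "card ?A = card (?W \<times> ?U) * q ^ ((h c - h a - t) * k)"
  proof (rule card_by_constant_fibres[where f = "\<lambda>z. (z \<inter> c, z \<squnion> c)"])
    show "finite ?A" "finite (?W \<times> ?U)" using finite_interval by auto
    show "(\<lambda>z. (z \<inter> c, z \<squnion> c)) ` ?A \<subseteq> ?W \<times> ?U"
    proof (rule image_subsetI)
      fix z assume z: "z \<in> ?A"
      then have "h (z \<squnion> c) = h c + k"
        using height_modular[of z c] assms by (auto simp: interval_def)
      then show "(z \<inter> c, z \<squnion> c) \<in> ?W \<times> ?U"
        using z assms join_in[of z c] join_upper(2)[of c z] join_least[of b z c]
        by (auto simp: interval_def intro: meet_in)
    qed
    fix y assume "y \<in> ?W \<times> ?U"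
    then obtain w u where y: "y = (w, u)" and w: "w \<in> ?W" and u: "u \<in> ?U" by auto
    have "{z \<in> ?A. (z \<inter> c, z \<squnion> c) = y} = complements w c u"
    proof (intro subset_antisym subsetI)
      fix z assume "z \<in> {z \<in> ?A. (z \<inter> c, z \<squnion> c) = y}"
      then show "z \<in> complements w c u" by (auto simp: complements_def interval_def y)
    next
      fix z assume z: "z \<in> complements w c u"
      have "h z + h c = h w + h u" by (rule complement_height[OF assms(2) z])
      moreover have "z \<subseteq> u" using z join_upper by (auto simp: complements_def)
      ultimately show "z \<in> {z \<in> ?A. (z \<inter> c, z \<squnion> c) = y}"
        using z w u by (auto simp: complements_def interval_def y)
    qed
    then show "card {z \<in> ?A. (z \<inter> c, z \<squnion> c) = y} = q ^ ((h c - h a - t) * k)"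
      using card_complements[of w c u] w u assms by (auto simp: interval_def)
  qed
  then show ?thesis
    using assms by (simp add: card_cartesian_product card_of_height)
qed

end

lemma qbinomial_symmetric:
  assumes "k \<le> n"
  shows "qbinomial q n (n - k) = qbinomial q n k"
proof -
  have pos: "0 < qfact q m" for m
    by (induction m) (simp_all add: qfact_def qint_pos)
  have "qbinomial q n k * (qfact q k * qfact q (n - k)) =
      qbinomial q n (n - k) * (qfact q k * qfact q (n - k))"
    using qbinomial_qfact[of k n q] qbinomial_qfact[of "n - k" n q] assms by (simp add: mult.commute)
  then show ?thesis
    using pos[of k] pos[of "n - k"] by simp
qed


section \<open>Prime-free intervals\<close>

locale ranked_q_lattice = q_lattice L h q for L :: "'a set set" and h q +
  fixes r :: "'a set \<Rightarrow> nat"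
  assumes rank: "rank_function L h r"
begin

lemma rank_mono: "\<lbrakk>x \<in> L; y \<in> L; x \<subseteq> y\<rbrakk> \<Longrightarrow> r x \<le> r y"
  and rank_submodular: "\<lbrakk>x \<in> L; y \<in> L\<rbrakk> \<Longrightarrow> r (x \<squnion> y) + r (x \<inter> y) \<le> r x + r y"
  and rank_le_height: "x \<in> L \<Longrightarrow> r x \<le> h x"
  using rank by (auto simp: rank_function_def)

text \<open>
  A complement \<open>p\<close> of \<open>x\<close> in \<open>[\<Inter>L, y]\<close> has rank at most \<open>h p = h y - h x\<close>; now apply
  submodularity to \<open>x\<close> and \<open>p\<close>.
\<close>

lemma nullity_mono:
  assumes "x \<in> L" "y \<in> L" "x \<subseteq> y"
  shows "r y + h x \<le> r x + h y"
proof -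
  have "0 < card (complements (\<Inter>L) x y)"
    using card_complements[OF bot_in assms(1,2) Inter_lower] assms q_pos by simp
  then obtain p where p: "p \<in> complements (\<Inter>L) x y"
    by (metis card.empty ex_in_conv less_irrefl)
  then have "p \<in> L" "p \<squnion> x = y" by (auto simp: complements_def)
  then show ?thesis
    using rank_submodular[of p x] rank_le_height[of p] complement_height[OF assms(1) p] assms
      height_bot by auto
qed

text \<open>
  Let \<open>c\<close> be maximal in \<open>[a, b]\<close> among the elements of the same rank as \<open>a\<close>. If some element of
  \<open>[c, b]\<close> were dependent over \<open>c\<close>, let \<open>z\<close> be one of least height. By maximality of \<open>c\<close>, it has
  height at least \<open>h c + 2\<close>, and everything strictly between \<open>c\<close> and \<open>z\<close> is independent over
  \<open>c\<close>; hence any diamond \<open>[d, z]\<close> above \<open>c\<close> is prime. So in a prime-free interval, \<open>[c, b]\<close> is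
  free while \<open>[a, c]\<close> has rank zero, and submodularity determines the rank everywhere.
\<close>

lemma prime_free_rank:
  assumes "a \<in> L" "b \<in> L" "a \<subseteq> b" "prime_free L h r a b"
  obtains c where "c \<in> L" "a \<subseteq> c" "c \<subseteq> b"
    "\<And>z. z \<in> interval L a b \<Longrightarrow> r z + h (z \<inter> c) = r a + h z"
proof -
  let ?S = "{z \<in> interval L a b. r z = r a}"
  have "a \<in> ?S" using assms by (auto simp: interval_def)
  then obtain c where "c \<in> ?S" and c_max: "\<And>z. \<lbrakk>z \<in> ?S; c \<subseteq> z\<rbrakk> \<Longrightarrow> c = z"
    using finite_has_maximal[of ?S] finite_interval by auto
  then have c: "c \<in> L" "a \<subseteq> c" "c \<subseteq> b" "r c = r a" by (auto simp: interval_def)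
  have free: "r z + h c = r c + h z" if "z \<in> L" "c \<subseteq> z" "z \<subseteq> b" for z
    using that
  proof (induction "h z" arbitrary: z rule: less_induct)
    case less
    have le: "r z + h c \<le> r c + h z" "h c \<le> h z" "r c \<le> r z"
      using nullity_mono[OF c(1)] height_mono[OF c(1)] rank_mono[OF c(1)] less.prems by auto
    consider "h z = h c" | "h z = h c + 1" | "h c + 2 \<le> h z" using le by linarith
    then show ?case
    proof cases
      case 1
      then have "c = z" using c less.prems by (intro height_eqD) auto
      then show ?thesis by simp
    next
      case 2
      then have "z \<notin> ?S" using c_max[of z] less.prems by auto
      then have "r z \<noteq> r c" using c less.prems by (auto simp: interval_def)
      then show ?thesis using le 2 by linarith
    next
      case 3
      show ?thesis
      proof (rule ccontr)
        assume "r z + h c \<noteq> r c + h z"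
        then have dep: "r z + h c < r c + h z" using le by linarith
        have "h c \<le> h z - 2" using 3 by linarith
        then obtain d where d: "d \<in> L" "c \<subseteq> d" "d \<subseteq> z" "h d = h z - 2"
          using element_of_height[of c z "h z - 2"] c less.prems by auto
        have rd: "r d + h c = r c + h d"
          using less.hyps[of d] d 3 less.prems by auto
        have "r x = r d + 1 \<and> r z = r x" if x: "x \<in> L" "d \<subset> x" "x \<subset> z" for x
        proof -
          have "h d < h x" "h x < h z" using height_strict x d(1) less.prems(1) by blast+
          moreover from this have "r x + h c = r c + h x"
            using less.hyps[of x] x d less.prems by auto
          moreover have "r x \<le> r z" using rank_mono x less.prems by auto
          ultimately show ?thesis using rd d(4) dep 3 by linarith
        qed
        then have "prime_diamond L h r d z"
          using d 3 less.prems by (auto simp: prime_diamond_def diamond_def)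
        then show False
          using assms(4) d c less.prems by (auto simp: prime_free_def)
      qed
    qed
  qed
  have "r z + h (z \<inter> c) = r a + h z" if "z \<in> interval L a b" for z
  proof -
    have z: "z \<in> L" "a \<subseteq> z" "z \<subseteq> b" using that by (auto simp: interval_def)
    have "a \<subseteq> z \<inter> c" using z c by auto
    then have "r (z \<inter> c) = r a"
      using rank_mono[of a "z \<inter> c"] rank_mono[of "z \<inter> c" c] c z assms meet_in[of z c] by auto
    then have "r (z \<squnion> c) \<le> r z"
      using rank_submodular[of z c] z c by auto
    moreover have "r z \<le> r (z \<squnion> c)"
      using rank_mono[of z "z \<squnion> c"] z c join_in join_upper by auto
    moreover have "r (z \<squnion> c) + h c = r c + h (z \<squnion> c)"
      using free[of "z \<squnion> c"] z c assms join_in join_upper join_least by auto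
    ultimately show ?thesis
      using height_modular[of z c] z c by auto
  qed
  then show thesis using that c by blast
qed

text \<open>
  With \<open>c\<close> as above, the exponents of the monomial of \<open>z\<close> are determined by the heights of
  \<open>z \<inter> c\<close> and of \<open>z\<close>, so collecting equal monomials reduces the sum to a count. The count involves
  the height \<open>i - s\<close> of \<open>z\<close> over \<open>z \<inter> c\<close> and \<open>alpha q\<close> involves the corank \<open>s\<close>; the symmetry of the
  q-binomial coefficients reconciles the two.
\<close>

lemma rank_gen_poly_interval:
  assumes "a \<in> L" "b \<in> L" "a \<subseteq> b" "r a = h a" "prime_free L h r a b"
  defines "i \<equiv> r b - r a" and "j \<equiv> nullity h r b - nullity h r a"
  shows "(\<Sum>z\<in>interval L a b. bimonom 1 (r b - r z) (nullity h r z)) =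
    (\<Sum>s\<le>i. \<Sum>t\<le>j. bimonom (int (alpha q i j s t)) s t)"
proof -
  obtain c where c: "c \<in> L" "a \<subseteq> c" "c \<subseteq> b"
    and rank_eq: "\<And>z. z \<in> interval L a b \<Longrightarrow> r z + h (z \<inter> c) = r a + h z"
    using prime_free_rank[OF assms(1-3,5)] by blast
  have heights: "h a \<le> h c" "h c \<le> h b" using height_mono c assms(1-3) by auto
  have rb: "r b + h c = h a + h b"
    using rank_eq[of b] assms(1-4) c by (auto simp: interval_def Int_absorb1)
  have i: "i = h b - h c" and j: "j = h c - h a"
    using rb assms(4) heights by (auto simp: i_def j_def nullity_def)
  let ?A = "interval L a b"
  let ?g = "\<lambda>z. (r b - r z, nullity h r z)"
  have bounds: "h a \<le> h (z \<inter> c)" "h (z \<inter> c) \<le> h c" "h (z \<inter> c) \<le> h z"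
    "h z + h c \<le> h b + h (z \<inter> c)" "r z + h (z \<inter> c) = h a + h z" if "z \<in> ?A" for z
  proof -
    have z: "z \<in> L" "a \<subseteq> z" "z \<subseteq> b" using that by (auto simp: interval_def)
    show "h a \<le> h (z \<inter> c)" "h (z \<inter> c) \<le> h c" "h (z \<inter> c) \<le> h z"
      using z c assms(1-3) by (auto intro!: height_mono meet_in)
    have "h (z \<squnion> c) \<le> h b"
      using z c assms(1-3) by (intro height_mono join_in join_least) auto
    then show "h z + h c \<le> h b + h (z \<inter> c)"
      using height_modular[of z c] z c by simp
    show "r z + h (z \<inter> c) = h a + h z" using rank_eq[OF that] assms(4) by simp
  qed
  have "(\<Sum>z\<in>?A. bimonom 1 (r b - r z) (nullity h r z)) =
      (\<Sum>y\<in>{..i} \<times> {..j}. \<Sum>z\<in>{z. z \<in> ?A \<and> ?g z = y}. bimonom 1 (r b - r z) (nullity h r z))"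
  proof (rule sum.group[symmetric])
    show "?g ` ?A \<subseteq> {..i} \<times> {..j}"
    proof (rule image_subsetI)
      fix z assume "z \<in> ?A"
      from bounds[OF this] show "?g z \<in> {..i} \<times> {..j}"
        using rb i j by (auto simp: nullity_def)
    qed
  qed (auto simp: finite_interval)
  also have "\<dots> = (\<Sum>y\<in>{..i} \<times> {..j}. bimonom (int (alpha q i j (fst y) (snd y))) (fst y) (snd y))"
  proof (rule sum.cong[OF refl])
    fix y assume "y \<in> {..i} \<times> {..j}"
    then obtain s t where y: "y = (s, t)" and st: "s \<le> i" "t \<le> j" by auto
    have "{z. z \<in> ?A \<and> ?g z = y} =
        {z \<in> ?A. h (z \<inter> c) = h a + t \<and> h z = h a + t + (i - s)}"
    proof (rule Collect_cong, rule conj_cong[OF refl])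
      fix z assume "z \<in> ?A"
      from bounds[OF this] show "(?g z = y) = (h (z \<inter> c) = h a + t \<and> h z = h a + t + (i - s))"
        using rb i j st y by (auto simp: nullity_def)
    qed
    then have "card {z. z \<in> ?A \<and> ?g z = y} =
        qbinomial q j t * qbinomial q i (i - s) * q ^ ((j - t) * (i - s))"
      using card_of_relative_height[of a c b t "i - s"] c assms(1,2) by (simp add: i j)
    then have "card {z. z \<in> ?A \<and> ?g z = y} = alpha q i j s t"
      using st by (simp add: alpha_def qbinomial_symmetric mult.commute)
    moreover have "(\<Sum>z\<in>{z. z \<in> ?A \<and> ?g z = y}. bimonom 1 (r b - r z) (nullity h r z)) =
        (\<Sum>z\<in>{z. z \<in> ?A \<and> ?g z = y}. bimonom 1 s t)"
      by (rule sum.cong) (auto simp: y)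
    ultimately show "(\<Sum>z\<in>{z. z \<in> ?A \<and> ?g z = y}. bimonom 1 (r b - r z) (nullity h r z)) =
        bimonom (int (alpha q i j (fst y) (snd y))) (fst y) (snd y)"
      by (simp add: y bimonom_def of_nat_poly mult_monom flip: monom_0)
  qed
  also have "\<dots> = (\<Sum>s\<le>i. \<Sum>t\<le>j. bimonom (int (alpha q i j s t)) s t)"
    by (simp add: sum.cartesian_product case_prod_unfold)
  finally show ?thesis .
qed

end


section \<open>Linearity of the transform\<close>

lemma bimonom_0 [simp]: "bimonom 0 i j = 0"
  by (simp add: bimonom_def)

lemma bimonom_add: "bimonom (c + d) i j = bimonom c i j + bimonom d i j"
  by (simp add: bimonom_def add_monom)

text \<open>
  The range of summation in the definition of \<open>alpha_star\<close> depends on the polynomial; linearity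
  becomes visible once it is replaced by an arbitrary finite set that contains the support.
\<close>

lemma alpha_star_eq_sum_support:
  assumes "finite S" "\<And>i j. bicoeff p i j \<noteq> 0 \<Longrightarrow> (j, i) \<in> S"
  shows "alpha_star q p =
    (\<Sum>(j, i)\<in>S. \<Sum>a\<le>i. \<Sum>b\<le>j. bimonom (bicoeff p i j * int (alpha q i j a b)) a b)"
    (is "_ = sum ?f S")
proof -
  let ?D = "SIGMA j:{..degree p}. {..degree (coeff p j)}"
  have D: "(j, i) \<in> ?D" if "bicoeff p i j \<noteq> 0" for i j
    using that by (auto simp: bicoeff_def intro!: le_degree)
  have zero: "?f y = 0" if "y \<notin> ?D \<or> y \<notin> S" for y
  proof -
    have "bicoeff p (snd y) (fst y) = 0"
      using that D[of "snd y" "fst y"] assms(2)[of "snd y" "fst y"] by (cases y) auto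
    then show ?thesis by (simp add: case_prod_unfold)
  qed
  have "alpha_star q p = sum ?f ?D"
    unfolding alpha_star_def by (subst sum.Sigma) auto
  also have "\<dots> = sum ?f (?D \<inter> S)"
    by (rule sum.mono_neutral_right) (use zero in blast)+
  also have "\<dots> = sum ?f S"
    by (rule sum.mono_neutral_left) (use assms(1) zero in blast)+
  finally show ?thesis .
qed

lemma alpha_star_add: "alpha_star q (p + p') = alpha_star q p + alpha_star q p'"
proof -
  let ?D = "\<lambda>p :: int poly poly. SIGMA j:{..degree p}. {..degree (coeff p j)}"
  let ?S = "?D p \<union> ?D p'"
  have fin: "finite ?S" by auto
  have D: "(j, i) \<in> ?D p" if "bicoeff p i j \<noteq> 0" for i j p
    using that by (auto simp: bicoeff_def intro!: le_degree)
  have add: "bicoeff (p + p') i j = bicoeff p i j + bicoeff p' i j" for i j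
    by (simp add: bicoeff_def)
  have supp: "(j, i) \<in> ?S" if "bicoeff p i j \<noteq> 0" for i j
    using D[OF that] by blast
  have supp': "(j, i) \<in> ?S" if "bicoeff p' i j \<noteq> 0" for i j
    using D[OF that] by blast
  have supp_add: "(j, i) \<in> ?S" if "bicoeff (p + p') i j \<noteq> 0" for i j
    using that supp[of i j] supp'[of i j] by (cases "bicoeff p i j = 0") (auto simp: add)
  let ?F = "\<lambda>p. \<Sum>(j, i)\<in>?S. \<Sum>a\<le>i. \<Sum>b\<le>j. bimonom (bicoeff p i j * int (alpha q i j a b)) a b"
  have "alpha_star q (p + p') = ?F (p + p')" "alpha_star q p = ?F p" "alpha_star q p' = ?F p'"
    by (rule alpha_star_eq_sum_support[OF fin]; fact supp supp' supp_add)+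
  then show ?thesis
    by (simp only: add distrib_right bimonom_add case_prod_unfold sum.distrib)
qed

lemma alpha_star_0 [simp]: "alpha_star q 0 = 0"
  by (simp add: alpha_star_def bicoeff_def)

lemma alpha_star_sum: "alpha_star q (sum f A) = (\<Sum>x\<in>A. alpha_star q (f x))"
  by (induction A rule: infinite_finite_induct) (auto simp: alpha_star_add)

lemma alpha_star_bimonom:
  "alpha_star q (bimonom c i j) = (\<Sum>a\<le>i. \<Sum>b\<le>j. bimonom (c * int (alpha q i j a b)) a b)"
  by (subst alpha_star_eq_sum_support[of "{(j, i)}"]) (auto simp: bicoeff_bimonom split: if_splits)

context ranked_q_lattice
begin

theorem rank_gen_poly_eq_alpha_star_tutte_poly:
  assumes "tutte_partition L h r P"
  shows "rank_gen_poly L h r = alpha_star q (tutte_poly h r P)"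
proof -
  have ends: "a \<in> L" "b \<in> L" "a \<subseteq> b" "r a = h a" "r b = r (\<Union>L)" "prime_free L h r a b"
    if "(a, b) \<in> P" for a b
    using assms that by (auto simp: tutte_partition_def)
  have part: "partition_on L ((\<lambda>(a, b). interval L a b) ` P)"
    using assms by (simp add: tutte_partition_def)
  have "finite P"
    using ends by (intro finite_subset[OF _ finite_cartesian_product[OF finite_L finite_L]]) auto
  have disj: "\<forall>x\<in>P. \<forall>y\<in>P. x \<noteq> y \<longrightarrow>
      (case x of (a, b) \<Rightarrow> interval L a b) \<inter> (case y of (a, b) \<Rightarrow> interval L a b) = {}"
  proof (intro ballI impI)
    fix x y assume P: "x \<in> P" "y \<in> P" and ne: "x \<noteq> y"
    obtain a b c d where xy: "x = (a, b)" "y = (c, d)" by (cases x, cases y)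
    then have "interval L a b \<noteq> interval L c d"
      using interval_eq_iff[of a L b c d] ends(1-3)[of a b] ends(1-3)[of c d] P ne by simp
    then show "(case x of (a, b) \<Rightarrow> interval L a b) \<inter> (case y of (a, b) \<Rightarrow> interval L a b) = {}"
      using disjointD[OF partition_onD2[OF part] imageI[OF P(1)] imageI[OF P(2)]] xy by simp
  qed
  have "rank_gen_poly L h r =
      (\<Sum>z\<in>(\<Union>(a, b)\<in>P. interval L a b). bimonom 1 (r (\<Union>L) - r z) (nullity h r z))"
    unfolding rank_gen_poly_def using partition_onD1[OF part] by simp
  also have "\<dots> = (\<Sum>(a, b)\<in>P. \<Sum>z\<in>interval L a b. bimonom 1 (r (\<Union>L) - r z) (nullity h r z))"
    using \<open>finite P\<close> disj
    by (subst sum.UNION_disjoint) (auto simp: finite_interval case_prod_unfold)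
  also have "\<dots> = (\<Sum>(a, b)\<in>P. alpha_star q (bimonom 1 (r b - r a) (nullity h r b - nullity h r a)))"
  proof (rule sum.cong[OF refl], clarify)
    fix a b assume "(a, b) \<in> P"
    from ends[OF this] show "(\<Sum>z\<in>interval L a b. bimonom 1 (r (\<Union>L) - r z) (nullity h r z)) =
        alpha_star q (bimonom 1 (r b - r a) (nullity h r b - nullity h r a))"
      using rank_gen_poly_interval[of a b] by (simp add: alpha_star_bimonom)
  qed
  also have "\<dots> = alpha_star q (tutte_poly h r P)"
    by (simp add: tutte_poly_def alpha_star_sum case_prod_unfold)
  finally show ?thesis .
qed

end


section \<open>Boolean lattices and subspace lattices\<close>

lemma q_lattice_Pow:
  assumes "finite E"
  shows "q_lattice (Pow E) card 1"
proof
  have "\<Inter>(Pow E) = {}" by blast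
  then show "card (\<Inter>(Pow E)) = 0" by simp
  fix x y assume xy: "x \<in> Pow E" "y \<in> Pow E"
  then have fin: "finite x" "finite y" using assms finite_subset by auto
  show "card (lat_join (Pow E) x y) + card (x \<inter> y) = card x + card y"
    using xy card_Un_Int[OF fin] by (simp add: lat_join_Pow)
  show "x \<subset> y \<Longrightarrow> card x < card y" using fin by (simp add: psubset_card_mono)
  assume "x \<subseteq> y"
  have "{z \<in> interval (Pow E) x y. card z = card x + 1} = (\<lambda>e. insert e x) ` (y - x)"
  proof (intro subset_antisym subsetI)
    fix z assume z: "z \<in> {z \<in> interval (Pow E) x y. card z = card x + 1}"
    then have "x \<subseteq> z" "z \<subseteq> y" "card (z - x) = 1"
      using fin by (auto simp: interval_def card_Diff_subset)
    then obtain e where "z - x = {e}" by (auto simp: card_1_singleton_iff)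
    then have "z = insert e x" "e \<in> y - x" using \<open>x \<subseteq> z\<close> \<open>z \<subseteq> y\<close> by auto
    then show "z \<in> (\<lambda>e. insert e x) ` (y - x)" by blast
  qed (use xy fin \<open>x \<subseteq> y\<close> in \<open>auto simp: interval_def\<close>)
  moreover have "inj_on (\<lambda>e. insert e x) (y - x)" by (auto simp: inj_on_def)
  ultimately show "card {z \<in> interval (Pow E) x y. card z = card x + 1} = qint 1 (card y - card x)"
    using fin \<open>x \<subseteq> y\<close> by (simp add: card_image card_Diff_subset qint_def)
qed (use assms in auto)

lemma card_span_independent:
  fixes scale :: "'k::{field,finite} \<Rightarrow> 'v::ab_group_add \<Rightarrow> 'v"
  assumes "vector_space scale" "finite A" "\<not> module.dependent scale A"
  shows "finite (module.span scale A) \<and> card (module.span scale A) = CARD('k) ^ card A"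
proof -
  interpret vector_space scale by fact
  show ?thesis using assms(2,3)
  proof (induction A rule: finite_induct)
    case empty
    then show ?case by simp
  next
    case (insert x A)
    then have x: "x \<notin> span A" and IH: "finite (span A)" "card (span A) = CARD('k) ^ card A"
      by (auto simp: independent_insert)
    let ?f = "\<lambda>(k, s). scale k x + s"
    have inj: "inj_on ?f (UNIV \<times> span A)"
    proof (clarsimp simp: inj_on_def)
      fix k s k' s'
      assume s: "s \<in> span A" "s' \<in> span A" and eq: "scale k x + s = scale k' x + s'"
      have "scale (k - k') x = s' - s"
        using eq by (simp add: scale_left_diff_distrib algebra_simps)
      then have "scale (k - k') x \<in> span A" using s by (simp add: span_diff)
      then have "k = k'"
        using x span_scale[of "scale (k - k') x" A "inverse (k - k')"] by (cases "k = k'") auto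
      then show "k = k' \<and> s = s'" using eq by simp
    qed
    have "span (insert x A) = ?f ` (UNIV \<times> span A)"
    proof (intro subset_antisym subsetI)
      fix y assume "y \<in> span (insert x A)"
      then obtain k where "y - scale k x \<in> span A" by (auto simp: span_insert)
      then show "y \<in> ?f ` (UNIV \<times> span A)"
        by (intro image_eqI[of _ _ "(k, y - scale k x)"]) auto
    next
      fix y assume "y \<in> ?f ` (UNIV \<times> span A)"
      then obtain k s where "y = scale k x + s" "s \<in> span A" by auto
      then show "y \<in> span (insert x A)" by (auto simp: span_insert intro!: exI[of _ k])
    qed
    then show ?case
      using inj IH insert.hyps by (simp add: card_image card_cartesian_product)
  qed
qed

text \<open>
  The atoms over a subspace \<open>a\<close> in \<open>[a, b]\<close> are the spans of \<open>insert v a\<close> for \<open>v \<in> b - a\<close>, and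
  each atom \<open>x\<close> arises from the \<open>card x - card a\<close> vectors in \<open>x - a\<close>.
\<close>

lemma q_lattice_subspaces:
  fixes scale :: "'k::{field,finite} \<Rightarrow> 'v::ab_group_add \<Rightarrow> 'v"
  assumes "finite_dimensional_vector_space scale B"
  shows "q_lattice (subspaces scale) (vector_space.dim scale) CARD('k)"
proof -
  interpret finite_dimensional_vector_space scale B by fact
  let ?q = "CARD('k)"
  note vs = vector_space_axioms
  have q2: "2 \<le> ?q"
    using card_mono[of UNIV "{0, 1 :: 'k}"] by simp
  have card_subspace: "finite S \<and> card S = ?q ^ dim S" if "subspace S" for S
  proof -
    obtain A where A: "A \<subseteq> S" "independent A" "S \<subseteq> span A" "card A = dim S"
      using basis_exists by blast
    then have "span A = S" using that by (simp add: span_minimal subset_antisym)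
    then show ?thesis
      using card_span_independent[OF vs finiteI_independent[OF A(2)] A(2)] A by auto
  qed
  then have "finite (UNIV :: 'v set)" using subspace_UNIV by blast
  then have fin: "finite S" "finite C" for S :: "'v set" and C :: "'v set set"
    using finite_subset[of S UNIV] finite_subset[of C "Pow UNIV"] finite_Pow_iff[of "UNIV :: 'v set"]
    by blast+
  show ?thesis
  proof
    show "finite (subspaces scale)" by (rule fin)
    show "subspaces scale \<noteq> {}" "\<Union>(subspaces scale) \<in> subspaces scale"
      using subspace_UNIV Union_subspaces[OF vs] by (auto simp: subspaces_def)
    have "\<Inter>(subspaces scale) = {0}"
      using subspace_0 Inter_lower[of "{0}" "subspaces scale"] by (auto simp: subspaces_def)
    then show "dim (\<Inter>(subspaces scale)) = 0" by simp
    show "0 < ?q" by simp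
    fix x y assume "x \<in> subspaces scale" "y \<in> subspaces scale"
    then have xy: "subspace x" "subspace y" by (auto simp: subspaces_def)
    then show "x \<inter> y \<in> subspaces scale" by (simp add: subspaces_def subspace_inter)
    show "x \<subset> y \<Longrightarrow> dim x < dim y"
      using dim_psubset[of x y] xy by (simp add: span_eq_iff[THEN iffD2])
    have "lat_join (subspaces scale) x y = {v + w |v w. v \<in> x \<and> w \<in> y}"
      using xy by (simp add: lat_join_subspaces[OF vs] span_Un span_eq_iff[THEN iffD2])
    then show "dim (lat_join (subspaces scale) x y) + dim (x \<inter> y) = dim x + dim y"
      using dim_sums_Int[OF xy] by simp
    assume "x \<subseteq> y"
    let ?T = "{z \<in> interval (subspaces scale) x y. dim z = dim x + 1}"
    have "card (y - x) = card ?T * (?q ^ (dim x + 1) - ?q ^ dim x)"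
    proof (rule card_by_constant_fibres[where f = "\<lambda>v. span (insert v x)"])
      show "finite (y - x)" "finite ?T" by (rule fin)+
      show "(\<lambda>v. span (insert v x)) ` (y - x) \<subseteq> ?T"
      proof (rule image_subsetI)
        fix v assume "v \<in> y - x"
        then have "dim (span (insert v x)) = dim x + 1" "span (insert v x) \<subseteq> y"
          using xy \<open>x \<subseteq> y\<close>
          by (simp_all add: dim_insert span_eq_iff[THEN iffD2] span_minimal)
        then show "span (insert v x) \<in> ?T"
          using span_superset[of "insert v x"] by (simp add: interval_def subspaces_def)
      qed
      fix z assume "z \<in> ?T"
      then have z: "subspace z" "x \<subseteq> z" "z \<subseteq> y" "dim z = dim x + 1"
        by (auto simp: interval_def subspaces_def)
      have "span (insert v x) = z" if "v \<in> z - x" for v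
        using that z xy
        by (intro subspace_dim_equal span_minimal)
          (auto simp: dim_insert span_eq_iff[THEN iffD2])
      moreover have "v \<in> span (insert v x)" for v by (simp add: span_base)
      ultimately have "{v \<in> y - x. span (insert v x) = z} = z - x"
        using z by blast
      then show "card {v \<in> y - x. span (insert v x) = z} = ?q ^ (dim x + 1) - ?q ^ dim x"
        using card_subspace[OF xy(1)] card_subspace[OF z(1)] z by (simp add: card_Diff_subset)
    qed
    moreover have "card (y - x) = ?q ^ dim y - ?q ^ dim x"
      using card_subspace xy \<open>x \<subseteq> y\<close> by (simp add: card_Diff_subset)
    \<comment> \<open>The geometric sum shows that both counts of \<open>y - x\<close> are divisible by the size of a fibre.\<close>
    moreover have "?q ^ (dim x + n) - ?q ^ dim x = qint ?q n * (?q ^ (dim x + 1) - ?q ^ dim x)" for n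
    proof -
      obtain p where p: "?q = Suc p" using q2 by (cases ?q) auto
      have "?q ^ (dim x + n) = ?q ^ dim x + ?q ^ dim x * (p * qint ?q n)"
        unfolding power_add p power_eq_qint[of p n] by (simp add: distrib_left)
      moreover have "?q ^ (dim x + 1) = ?q ^ dim x + ?q ^ dim x * p"
        by (simp add: p)
      ultimately show ?thesis by simp
    qed
    from this[of "dim y - dim x"]
    have "?q ^ dim y - ?q ^ dim x =
        qint ?q (dim y - dim x) * (?q ^ (dim x + 1) - ?q ^ dim x)"
      using dim_subset[OF \<open>x \<subseteq> y\<close>] by simp
    moreover have "0 < ?q ^ (dim x + 1) - ?q ^ dim x"
      using q2 by simp
    ultimately have
      "card ?T * (?q ^ (dim x + 1) - ?q ^ dim x) =
        qint ?q (dim y - dim x) * (?q ^ (dim x + 1) - ?q ^ dim x)"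
      "?q ^ (dim x + 1) - ?q ^ dim x \<noteq> 0"
      by linarith+
    then show "card ?T = qint ?q (dim y - dim x)"
      using mult_right_cancel by blast
  qed
qed

theorem proposition67:
  fixes E :: "'a set" and r :: "'a set \<Rightarrow> nat" and P :: "('a set \<times> 'a set) set"
    and scale :: "'k::{field,finite} \<Rightarrow> 'v::ab_group_add \<Rightarrow> 'v" and B :: "'v set"
    and r' :: "'v set \<Rightarrow> nat" and P' :: "('v set \<times> 'v set) set"
  shows
    "(matroid E r \<and> tutte_partition (Pow E) card r P \<longrightarrow>
        rank_gen_poly (Pow E) card r = alpha_star 1 (tutte_poly card r P)) \<and>
     (q_matroid scale B r' \<and>
        tutte_partition (subspaces scale) (vector_space.dim scale) r' P' \<longrightarrow>
        rank_gen_poly (subspaces scale) (vector_space.dim scale) r' =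
          alpha_star CARD('k) (tutte_poly (vector_space.dim scale) r' P'))"
proof (intro conjI impI; elim conjE)
  assume "matroid E r" and P: "tutte_partition (Pow E) card r P"
  then interpret ranked_q_lattice "Pow E" card 1 r
    by (simp add: matroid_def ranked_q_lattice_def ranked_q_lattice_axioms_def q_lattice_Pow
        del: One_nat_def)
  show "rank_gen_poly (Pow E) card r = alpha_star 1 (tutte_poly card r P)"
    by (rule rank_gen_poly_eq_alpha_star_tutte_poly[OF P])
next
  assume "q_matroid scale B r'"
    and P': "tutte_partition (subspaces scale) (vector_space.dim scale) r' P'"
  then interpret ranked_q_lattice "subspaces scale" "vector_space.dim scale" "CARD('k)" r'
    by (auto simp: q_matroid_def ranked_q_lattice_def ranked_q_lattice_axioms_def
        intro: q_lattice_subspaces)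
  show "rank_gen_poly (subspaces scale) (vector_space.dim scale) r' =
      alpha_star CARD('k) (tutte_poly (vector_space.dim scale) r' P')"
    by (rule rank_gen_poly_eq_alpha_star_tutte_poly[OF P'])
qed

end
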